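(* Let $\Theta\subset\mathbb{R}^q$ be a known compact set and $\theta\in\Theta$. Suppose that Assumptions 1–3 stated in the context hold. Then the estimation error system $$\dot{\tilde\theta}=H(\theta,\tilde\theta,x_r)+\Delta(\theta,\tilde\theta,x_r,e)$$ is uniformly ISS with respect to state $\tilde\theta\in\mathbb{R}^q$ and input $e\in\mathbb{R}^n$, with the uniform ISS-Lyapunov function $V_{est}(t,\tilde\theta)$ (introduced in the context together with the constants $a_1,\dots,a_4$) fulfilling $a_1|\tilde\theta|^2\le V_{est}(t,\tilde\theta)\le a_2|\tilde\theta|^2$, $\left|\frac{\partial V_{est}}{\partial\tilde\theta}\right|\le a_4|\tilde\theta|$, and, along the system, $$V_{est}\ge\sigma_{\tilde\theta,e}(|e|)\ \Longrightarrow\ \dot V_{est}(t,\tilde\theta)\le-\frac{a_3(\tau_{est}-1)}{\tau_{est}}|\tilde\theta|^2$$ for any $\tau_{est}>1$, where $$\sigma_{\tilde\theta,e}(s)=a_1(\tau_{est}a^\ast l_\gamma)^2\kappa_2(s)^2,\qquad a^\ast=\frac{\sqrt{a_2}\,a_4}{\sqrt{a_1}\,a_3}.$$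
   Context: Notation. $|\cdot|$ is the Euclidean norm (induced norm for matrices), $\mathbb{B}_r^k=\{x\in\mathbb{R}^k:|x|\le r\}$, $\mathbb{R}_+=[0,\infty)$. $\mathcal{K}$: continuous strictly increasing functions $\mathbb{R}_+\to\mathbb{R}_+$ vanishing at $0$; $\mathcal{K}_\infty$: unbounded functions in $\mathcal{K}$. Uniform ISS. A system $\dot z=f(t,z,w)$ is uniformly ISS with respect to state $z$ and input $w$ if it admits a uniform ISS-Lyapunov function: a $C^1$ function $V(t,z)\ge0$ for which there are $\underline\alpha,\bar\alpha,\alpha\in\mathcal{K}_\infty$, $\sigma\in\mathcal{K}$ such that $\underline\alpha(|z|)\le V(t,z)\le\bar\alpha(|z|)$ and $V(t,z)\ge\sigma(|w|)\Rightarrow\frac{\partial V}{\partial t}+\frac{\partial V}{\partial z}f(t,z,w)\le-\alpha(|z|)$. Saturation and dead zone. $l_\theta\ge\max_{\theta\in\Theta}|\theta|$; saturation level $l_s>l_\theta$ (chosen as in Assumption 3), margin $0<\epsilon_s\le1$. $\mathrm{sat}(s)=s$ if $|s|\le l_s$; $\mathrm{sat}(s)=s-\mathrm{sign}(s)\frac{(|s|-l_s)^2}{2\epsilon_s}$ if $l_s\le|s|\le l_s+\epsilon_s$; $\mathrm{sat}(s)=(l_s+0.5\epsilon_s)\mathrm{sign}(s)$ if $|s|\ge l_s+\epsilon_s$. $\mathrm{dz}(s)=0$ if $|s|\le l_\theta$; $\mathrm{dz}(s)=(|s|-l_\theta)^2[2(l_\theta+1)^2-(2l_\theta+1)|s|]\,\mathrm{sign}(s)$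 if $l_\theta<|s|<l_\theta+1$; $\mathrm{dz}(s)=s$ if $|s|\ge l_\theta+1$. $\mathrm{satv}$ and $\mathrm{dzv}$ apply $\mathrm{sat}$ and $\mathrm{dz}$ componentwise on $\mathbb{R}^q$. Assumption 1. $\phi(\theta,x)\in\mathbb{R}^n$ is $C^1$ in $\theta\in\mathbb{R}^q$, for all $x\in\mathbb{R}^n$. Assumption 2. The reference $x_r(t)$ is $C^1$; there is $r_1>0$ with $x_r(t)\in\mathbb{B}_{r_1}^n$ for all $t\ge0$; $x_r(t)$ and $\dot x_r(t)$ are known a priori. Assumption 3. There exist $l_s>\sqrt q\,l_\theta$ and a continuous $\varsigma:\mathbb{R}^n\to\mathbb{R}^{q\times n}$ such that $(\theta'-\theta)^\top\varsigma(x_r)[\phi(\theta',x_r)-\phi(\theta,x_r)]\ge(\theta'-\theta)^\top M_1(x_r)(\theta'-\theta)\ge0$ for all $\theta\in\Theta$ and $|\theta'|\le l_s$ (with $x_r=x_r(t)$ the reference), for some continuous $M_1:\mathbb{R}^n\to\mathbb{R}^{q\times q}$ satisfying $\int_t^{t+\delta}\big(M_1(x_r(\tau))+M_1^\top(x_r(\tau))\big)d\tau\ge\mu I$ for some constants $\delta,\mu>0$ and all $t\ge0$. Derived objects. $\tilde\phi_s(\theta^\dag,\theta^\ddag,x)=\phi(\mathrm{satv}(\theta^\dag+\theta^\ddag),x)-\phi(\mathrm{satv}(\theta^\dag),x)$. $\gamma_s\in\mathcal{K}\setminus\mathcal{K}_\infty$ and the constant $l_\gamma>0$ satisfy $\gamma_s(s)\le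 l_\gamma$, $\gamma_s(s)\le s$ for all $s\ge0$, and $|\mathrm{satv}(\theta+\tilde\theta)-\theta|\le\gamma_s(|\tilde\theta|)$ for all $\theta\in\Theta$, $\tilde\theta\in\mathbb{R}^q$. With $\varphi(\theta^\dag,x_r,e^\dag)=\varsigma(x_r)\phi(\theta^\dag,x_r)-\varsigma(e^\dag)\phi(\theta^\dag,e^\dag)$, $\kappa_2\in\mathcal{K}$ is a function (whose existence the paper derives from Assumptions 1 and 2) such that $|\varphi(\theta^\dag,x_r,e+x_r)-\varphi(\theta^\ddag,x_r,e+x_r)|\le\kappa_2(|e|)|\theta^\dag-\theta^\ddag|$ for all $x_r\in\mathbb{B}_{r_1}^n$, $e\in\mathbb{R}^n$, $\theta^\dag,\theta^\ddag\in\mathbb{B}^q_{l_s+0.5\epsilon_s}$. $H(\theta,\tilde\theta,x_r)=-\varsigma(x_r)\tilde\phi_s(\theta,\tilde\theta,x_r)-k_{dz}\,\mathrm{dzv}(\tilde\theta+\theta)$ and $\Delta(\theta,\tilde\theta,x_r,e)=\varphi(\mathrm{satv}(\theta),x_r,e+x_r)-\varphi(\mathrm{satv}(\theta+\tilde\theta),x_r,e+x_r)$. Choice of $k_{dz}$, $V_{est}$ and constants $a_i$. The paper derives from Assumptions 1–3 that there is $k_{dz}^\star>0$ such that for all $k_{dz}\ge k_{dz}^\star$ there are a $C^1$ function $V_{est}:\mathbb{R}_+\times\mathbb{R}^q\to\mathbb{R}_+$ and constants $a_1,\dots,a_4>0$ with $a_1|\tilde\theta|^2\le V_{est}(t,\tilde\theta)\le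 a_2|\tilde\theta|^2$, $\frac{\partial V_{est}}{\partial t}+\frac{\partial V_{est}}{\partial\tilde\theta}H(\theta,\tilde\theta,x_r)\le-a_3|\tilde\theta|^2$, $\left|\frac{\partial V_{est}}{\partial\tilde\theta}\right|\le a_4|\tilde\theta|$. The design gain is fixed with $k_{dz}\ge k_{dz}^\star$, and $V_{est}$ and the $a_i$ are this function and these constants.
   Formalization: The Lipschitz bound defining κ₂ is required for parameters in the cube with all components at most l_s+0.5ε_s in absolute value (the values of satv), not just in the Euclidean ball of that radius; with the ball alone the claim fails for q ≥ 2. *)

theory Defs
  imports "HOL-Analysis.Analysis"
begin

text \<open>Functions on the half-line are total functions on \<^typ>\<open>real\<close> of which only the
  restriction to \<open>{0..}\<close> matters.\<close>

definition class_K :: "(real \<Rightarrow> real) set" where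
  "class_K = {f. continuous_on {0..} f \<and> strict_mono_on {0..} f \<and> f 0 = 0}"

definition class_Kinf :: "(real \<Rightarrow> real) set" where
  "class_Kinf = {f \<in> class_K. \<not> bdd_above (f ` {0..})}"

text \<open>Derivatives are taken within \<open>S\<close>, so that on \<open>{0..}\<close> and \<open>{0..} \<times> UNIV\<close> they are
  one-sided in time at \<open>t = 0\<close>.\<close>

definition C1_on ::
  "'a::real_normed_vector set \<Rightarrow> ('a \<Rightarrow> 'b::real_normed_vector) \<Rightarrow> bool" where
  "C1_on S f \<longleftrightarrow>
    (\<exists>f' :: 'a \<Rightarrow> 'a \<Rightarrow>\<^sub>L 'b.
      (\<forall>x\<in>S. (f has_derivative blinfun_apply (f' x)) (at x within S)) \<and> continuous_on S f')"

definition partial_t :: "(real \<Rightarrow> 'z::real_normed_vector \<Rightarrow> real) \<Rightarrow> real \<Rightarrow> 'z \<Rightarrow> real" where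
  "partial_t V t z = vector_derivative (\<lambda>s. V s z) (at t within {0..})"

text \<open>The row vector of partial derivatives in \<open>z\<close>, as a linear functional; its Euclidean
  (equivalently, induced) norm is \<^const>\<open>onorm\<close>.\<close>

definition partial_z ::
  "(real \<Rightarrow> 'z::real_normed_vector \<Rightarrow> real) \<Rightarrow> real \<Rightarrow> 'z \<Rightarrow> 'z \<Rightarrow> real" where
  "partial_z V t z = frechet_derivative (V t) (at z)"

definition deriv_along ::
  "(real \<Rightarrow> 'z::real_normed_vector \<Rightarrow> real) \<Rightarrow> real \<Rightarrow> 'z \<Rightarrow> 'z \<Rightarrow> real" where
  "deriv_along V t z v = partial_t V t z + partial_z V t z v"

definition uniform_ISS_Lyapunov ::
  "(real \<Rightarrow> 'z::real_normed_vector \<Rightarrow> 'w::real_normed_vector \<Rightarrow> 'z) \<Rightarrow> (real \<Rightarrow> 'z \<Rightarrow> real) \<Rightarrow> bool"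
where
  "uniform_ISS_Lyapunov f V \<longleftrightarrow>
    C1_on ({0..} \<times> UNIV) (\<lambda>(t, z). V t z) \<and>
    (\<forall>t\<ge>0. \<forall>z. 0 \<le> V t z) \<and>
    (\<exists>\<alpha>\<^sub>l \<in> class_Kinf. \<exists>\<alpha>\<^sub>u \<in> class_Kinf. \<exists>\<alpha> \<in> class_Kinf. \<exists>\<sigma> \<in> class_K.
      (\<forall>t\<ge>0. \<forall>z. \<alpha>\<^sub>l (norm z) \<le> V t z \<and> V t z \<le> \<alpha>\<^sub>u (norm z)) \<and>
      (\<forall>t\<ge>0. \<forall>z w. \<sigma> (norm w) \<le> V t z \<longrightarrow> deriv_along V t z (f t z w) \<le> - \<alpha> (norm z)))"

definition uniformly_ISS ::
  "(real \<Rightarrow> 'z::real_normed_vector \<Rightarrow> 'w::real_normed_vector \<Rightarrow> 'z) \<Rightarrow> bool" where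
  "uniformly_ISS f \<longleftrightarrow> (\<exists>V. uniform_ISS_Lyapunov f V)"

definition sat :: "real \<Rightarrow> real \<Rightarrow> real \<Rightarrow> real" where
  "sat l\<^sub>s \<epsilon>\<^sub>s s =
    (if \<bar>s\<bar> \<le> l\<^sub>s then s
     else if \<bar>s\<bar> \<le> l\<^sub>s + \<epsilon>\<^sub>s then s - sgn s * ((\<bar>s\<bar> - l\<^sub>s)\<^sup>2 / (2 * \<epsilon>\<^sub>s))
     else (l\<^sub>s + 0.5 * \<epsilon>\<^sub>s) * sgn s)"

definition dz :: "real \<Rightarrow> real \<Rightarrow> real" where
  "dz l\<^sub>\<theta> s =
    (if \<bar>s\<bar> \<le> l\<^sub>\<theta> then 0
     else if \<bar>s\<bar> < l\<^sub>\<theta> + 1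
       then (\<bar>s\<bar> - l\<^sub>\<theta>)\<^sup>2 * (2 * (l\<^sub>\<theta> + 1)\<^sup>2 - (2 * l\<^sub>\<theta> + 1) * \<bar>s\<bar>) * sgn s
     else s)"

definition satv :: "real \<Rightarrow> real \<Rightarrow> real^'q \<Rightarrow> real^'q" where
  "satv l\<^sub>s \<epsilon>\<^sub>s v = (\<chi> i. sat l\<^sub>s \<epsilon>\<^sub>s (v $ i))"

definition dzv :: "real \<Rightarrow> real^'q \<Rightarrow> real^'q" where
  "dzv l\<^sub>\<theta> v = (\<chi> i. dz l\<^sub>\<theta> (v $ i))"

definition smooth_regressor :: "(real^'q \<Rightarrow> real^'n \<Rightarrow> real^'n) \<Rightarrow> bool" where
  "smooth_regressor \<phi> \<longleftrightarrow> (\<forall>x. C1_on UNIV (\<lambda>\<theta>. \<phi> \<theta> x))"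

definition C1_bounded_reference :: "(real \<Rightarrow> real^'n) \<Rightarrow> real \<Rightarrow> bool" where
  "C1_bounded_reference x\<^sub>r r\<^sub>1 \<longleftrightarrow> C1_on {0..} x\<^sub>r \<and> r\<^sub>1 > 0 \<and> (\<forall>t\<ge>0. x\<^sub>r t \<in> cball 0 r\<^sub>1)"

definition loewner_le :: "real^'q^'q \<Rightarrow> real^'q^'q \<Rightarrow> bool" where
  "loewner_le A B \<longleftrightarrow> (\<forall>v. v \<bullet> (A *v v) \<le> v \<bullet> (B *v v))"

text \<open>From here on the function \<open>S\<close> is the matrix-valued map written ``varsigma'' in
  mathematical notation, which is not available as an identifier.\<close>

definition persistent_excitation ::
  "(real^'q) set \<Rightarrow> (real^'q \<Rightarrow> real^'n \<Rightarrow> real^'n) \<Rightarrow> (real \<Rightarrow> real^'n) \<Rightarrow>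
   real \<Rightarrow> real \<Rightarrow> (real^'n \<Rightarrow> real^'n^'q) \<Rightarrow> bool"
where
  "persistent_excitation \<Theta> \<phi> x\<^sub>r l\<^sub>\<theta> l\<^sub>s S \<longleftrightarrow>
    l\<^sub>s > sqrt (real CARD('q)) * l\<^sub>\<theta> \<and>
    continuous_on UNIV S \<and>
    (\<exists>M\<^sub>1 :: real^'n \<Rightarrow> real^'q^'q.
      continuous_on UNIV M\<^sub>1 \<and>
      (\<forall>t\<ge>0. \<forall>\<theta>\<in>\<Theta>. \<forall>\<theta>'. norm \<theta>' \<le> l\<^sub>s \<longrightarrow>
        (\<theta>' - \<theta>) \<bullet> (S (x\<^sub>r t) *v (\<phi> \<theta>' (x\<^sub>r t) - \<phi> \<theta> (x\<^sub>r t)))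
          \<ge> (\<theta>' - \<theta>) \<bullet> (M\<^sub>1 (x\<^sub>r t) *v (\<theta>' - \<theta>)) \<and>
        (\<theta>' - \<theta>) \<bullet> (M\<^sub>1 (x\<^sub>r t) *v (\<theta>' - \<theta>)) \<ge> 0) \<and>
      (\<exists>\<delta>>0. \<exists>\<mu>>0. \<forall>t\<ge>0.
        loewner_le (\<mu> *\<^sub>R mat 1)
          (integral {t..t + \<delta>} (\<lambda>\<tau>. M\<^sub>1 (x\<^sub>r \<tau>) + transpose (M\<^sub>1 (x\<^sub>r \<tau>))))))"

definition phi_s ::
  "(real^'q \<Rightarrow> real^'n \<Rightarrow> real^'n) \<Rightarrow> real \<Rightarrow> real \<Rightarrow> real^'q \<Rightarrow> real^'q \<Rightarrow> real^'n \<Rightarrow> real^'n" where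
  "phi_s \<phi> l\<^sub>s \<epsilon>\<^sub>s \<theta>1 \<theta>2 x = \<phi> (satv l\<^sub>s \<epsilon>\<^sub>s (\<theta>1 + \<theta>2)) x - \<phi> (satv l\<^sub>s \<epsilon>\<^sub>s \<theta>1) x"

definition varphi ::
  "(real^'q \<Rightarrow> real^'n \<Rightarrow> real^'n) \<Rightarrow> (real^'n \<Rightarrow> real^'n^'q) \<Rightarrow>
   real^'q \<Rightarrow> real^'n \<Rightarrow> real^'n \<Rightarrow> real^'q" where
  "varphi \<phi> S \<theta>1 x e1 = S x *v \<phi> \<theta>1 x - S e1 *v \<phi> \<theta>1 e1"

definition H_est ::
  "(real^'q \<Rightarrow> real^'n \<Rightarrow> real^'n) \<Rightarrow> (real^'n \<Rightarrow> real^'n^'q) \<Rightarrow> real \<Rightarrow> real \<Rightarrow> real \<Rightarrow> real \<Rightarrow>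
   real^'q \<Rightarrow> real^'q \<Rightarrow> real^'n \<Rightarrow> real^'q" where
  "H_est \<phi> S l\<^sub>\<theta> l\<^sub>s \<epsilon>\<^sub>s k \<theta> z x =
    - (S x *v phi_s \<phi> l\<^sub>s \<epsilon>\<^sub>s \<theta> z x) - k *\<^sub>R dzv l\<^sub>\<theta> (z + \<theta>)"

definition Delta_est ::
  "(real^'q \<Rightarrow> real^'n \<Rightarrow> real^'n) \<Rightarrow> (real^'n \<Rightarrow> real^'n^'q) \<Rightarrow> real \<Rightarrow> real \<Rightarrow>
   real^'q \<Rightarrow> real^'q \<Rightarrow> real^'n \<Rightarrow> real^'n \<Rightarrow> real^'q" where
  "Delta_est \<phi> S l\<^sub>s \<epsilon>\<^sub>s \<theta> z x e =
    varphi \<phi> S (satv l\<^sub>s \<epsilon>\<^sub>s \<theta>) x (e + x) - varphi \<phi> S (satv l\<^sub>s \<epsilon>\<^sub>s (\<theta> + z)) x (e + x)"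

definition est_error_system ::
  "(real^'q \<Rightarrow> real^'n \<Rightarrow> real^'n) \<Rightarrow> (real^'n \<Rightarrow> real^'n^'q) \<Rightarrow> real \<Rightarrow> real \<Rightarrow> real \<Rightarrow> real \<Rightarrow>
   (real \<Rightarrow> real^'n) \<Rightarrow> real^'q \<Rightarrow> real \<Rightarrow> real^'q \<Rightarrow> real^'n \<Rightarrow> real^'q" where
  "est_error_system \<phi> S l\<^sub>\<theta> l\<^sub>s \<epsilon>\<^sub>s k x\<^sub>r \<theta> t z e =
    H_est \<phi> S l\<^sub>\<theta> l\<^sub>s \<epsilon>\<^sub>s k \<theta> z (x\<^sub>r t) + Delta_est \<phi> S l\<^sub>s \<epsilon>\<^sub>s \<theta> z (x\<^sub>r t) e"

definition gamma_s_bound ::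
  "(real^'q) set \<Rightarrow> real \<Rightarrow> real \<Rightarrow> (real \<Rightarrow> real) \<Rightarrow> real \<Rightarrow> bool" where
  "gamma_s_bound \<Theta> l\<^sub>s \<epsilon>\<^sub>s \<gamma>\<^sub>s l\<^sub>\<gamma> \<longleftrightarrow>
    \<gamma>\<^sub>s \<in> class_K - class_Kinf \<and> l\<^sub>\<gamma> > 0 \<and>
    (\<forall>s\<ge>0. \<gamma>\<^sub>s s \<le> l\<^sub>\<gamma> \<and> \<gamma>\<^sub>s s \<le> s) \<and>
    (\<forall>\<theta>\<in>\<Theta>. \<forall>z. norm (satv l\<^sub>s \<epsilon>\<^sub>s (\<theta> + z) - \<theta>) \<le> \<gamma>\<^sub>s (norm z))"

text \<open>Since \<^const>\<open>satv\<close> saturates componentwise, its values fill the cube of half-width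
  \<open>l\<^sub>s + 0.5 * \<epsilon>\<^sub>s\<close>. The Euclidean ball of that radius does not contain this cube when the
  dimension exceeds one, so the Lipschitz bound below is required on the cube.\<close>

definition sat_cube :: "real \<Rightarrow> real \<Rightarrow> (real^'q) set" where
  "sat_cube l\<^sub>s \<epsilon>\<^sub>s = {v. \<forall>i. \<bar>v $ i\<bar> \<le> l\<^sub>s + 0.5 * \<epsilon>\<^sub>s}"

definition kappa2_bound ::
  "(real^'q \<Rightarrow> real^'n \<Rightarrow> real^'n) \<Rightarrow> (real^'n \<Rightarrow> real^'n^'q) \<Rightarrow> real \<Rightarrow> real \<Rightarrow> real \<Rightarrow>
   (real \<Rightarrow> real) \<Rightarrow> bool" where
  "kappa2_bound \<phi> S l\<^sub>s \<epsilon>\<^sub>s r\<^sub>1 \<kappa>\<^sub>2 \<longleftrightarrow>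
    \<kappa>\<^sub>2 \<in> class_K \<and>
    (\<forall>x \<in> cball 0 r\<^sub>1. \<forall>e. \<forall>\<theta>1 \<in> sat_cube l\<^sub>s \<epsilon>\<^sub>s. \<forall>\<theta>2 \<in> sat_cube l\<^sub>s \<epsilon>\<^sub>s.
      norm (varphi \<phi> S \<theta>1 x (e + x) - varphi \<phi> S \<theta>2 x (e + x))
        \<le> \<kappa>\<^sub>2 (norm e) * norm (\<theta>1 - \<theta>2))"

text \<open>\<open>F t z\<close> is the vector field of the error system with \<open>e = 0\<close>, at the fixed
  parameter and along the reference.\<close>

definition est_Lyapunov ::
  "(real \<Rightarrow> real^'q \<Rightarrow> real^'q) \<Rightarrow> (real \<Rightarrow> real^'q \<Rightarrow> real) \<Rightarrow>
   real \<Rightarrow> real \<Rightarrow> real \<Rightarrow> real \<Rightarrow> bool" where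
  "est_Lyapunov F V a\<^sub>1 a\<^sub>2 a\<^sub>3 a\<^sub>4 \<longleftrightarrow>
    a\<^sub>1 > 0 \<and> a\<^sub>2 > 0 \<and> a\<^sub>3 > 0 \<and> a\<^sub>4 > 0 \<and>
    C1_on ({0..} \<times> UNIV) (\<lambda>(t, z). V t z) \<and>
    (\<forall>t\<ge>0. \<forall>z. 0 \<le> V t z \<and>
      a\<^sub>1 * (norm z)\<^sup>2 \<le> V t z \<and> V t z \<le> a\<^sub>2 * (norm z)\<^sup>2 \<and>
      deriv_along V t z (F t z) \<le> - a\<^sub>3 * (norm z)\<^sup>2 \<and>
      onorm (partial_z V t z) \<le> a\<^sub>4 * norm z)"

definition a_star :: "real \<Rightarrow> real \<Rightarrow> real \<Rightarrow> real \<Rightarrow> real" where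
  "a_star a\<^sub>1 a\<^sub>2 a\<^sub>3 a\<^sub>4 = (sqrt a\<^sub>2 * a\<^sub>4) / (sqrt a\<^sub>1 * a\<^sub>3)"

definition sigma_est ::
  "real \<Rightarrow> real \<Rightarrow> real \<Rightarrow> real \<Rightarrow> real \<Rightarrow> (real \<Rightarrow> real) \<Rightarrow> real \<Rightarrow> real \<Rightarrow> real" where
  "sigma_est a\<^sub>1 a\<^sub>2 a\<^sub>3 a\<^sub>4 l\<^sub>\<gamma> \<kappa>\<^sub>2 \<tau> s =
    a\<^sub>1 * (\<tau> * a_star a\<^sub>1 a\<^sub>2 a\<^sub>3 a\<^sub>4 * l\<^sub>\<gamma>)\<^sup>2 * (\<kappa>\<^sub>2 s)\<^sup>2"

end

theory Submission
  imports Defs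
begin

text \<open>The input \<open>e\<close> enters only through \<open>Delta_est\<close>, which perturbs
  a nominal system whose Lyapunov function decays quadratically. Saturation makes this perturbation
  bounded uniformly in the state: by \<open>norm_Delta_est_le\<close> its norm is at most d =
  \<open>\<kappa>\<^sub>2 (norm e) * l\<^sub>\<gamma>\<close>. Since the gradient of V grows at most
  linearly, the perturbation adds at most \<open>a\<^sub>4 * norm z * d\<close> to the derivative of
  V along the system. If V lies above the threshold \<open>sigma_est\<close>, then the upper bound
  \<open>a\<^sub>2 * (norm z)\<^sup>2\<close> on V forces \<open>norm z\<close> to be at least
  \<open>\<tau> * a\<^sub>4 * d / a\<^sub>3\<close>, so this extra term consumes at most the
  fraction 1/\<tau> of the nominal decay (\<open>perturbed_decay\<close>). The comparison functions
  required for ISS are then multiples of squares, supplied by \<open>class_K_scaled_square\<close>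
  and \<open>class_Kinf_scaled_square\<close>.\<close>

lemma class_K_nonneg:
  assumes "f \<in> class_K" "0 \<le> s"
  shows "0 \<le> f s"
proof -
  have "mono_on {0..} f" "f 0 = 0"
    using assms(1) by (auto simp: class_K_def intro: strict_mono_on_imp_mono_on)
  then show ?thesis
    using mono_onD[of "{0..}" f 0 s] assms(2) by auto
qed

lemma class_K_scaled_square:
  assumes "c > 0" "f \<in> class_K"
  shows "(\<lambda>s. c * (f s)\<^sup>2) \<in> class_K"
proof -
  have "continuous_on {0..} (\<lambda>s. c * (f s)\<^sup>2)"
    using assms(2) by (auto simp: class_K_def intro!: continuous_intros)
  moreover have "strict_mono_on {0..} (\<lambda>s. c * (f s)\<^sup>2)"
  proof (rule strict_mono_onI)
    fix r s :: real
    assume "r \<in> {0..}" "s \<in> {0..}" "r < s"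
    then have "0 \<le> f r" "f r < f s"
      using assms(2) class_K_nonneg[OF assms(2)] by (auto simp: class_K_def strict_mono_on_def)
    then show "c * (f r)\<^sup>2 < c * (f s)\<^sup>2"
      using \<open>c > 0\<close> by (simp add: power_strict_mono)
  qed
  ultimately show ?thesis
    using assms(2) by (simp add: class_K_def)
qed

lemma class_Kinf_scaled_square:
  assumes "c > 0"
  shows "(\<lambda>s. c * s\<^sup>2) \<in> class_Kinf"
proof -
  have "(\<lambda>s. s) \<in> class_K"
    by (auto simp: class_K_def strict_mono_on_def)
  then have "(\<lambda>s. c * s\<^sup>2) \<in> class_K"
    using class_K_scaled_square[OF assms, of "\<lambda>s. s"] by simp
  moreover have "\<not> bdd_above ((\<lambda>s. c * s\<^sup>2) ` {0..})"
  proof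
    assume "bdd_above ((\<lambda>s. c * s\<^sup>2) ` {0..})"
    then obtain M where M: "c * s\<^sup>2 \<le> M" if "s \<ge> 0" for s
      by (auto simp: bdd_above_def)
    have "0 \<le> M" using M[of 0] by simp
    \<comment> \<open>The shift by 1 serves twice: it gives s \<ge> 1, so that squaring does not
      decrease s, and it makes c * s exceed M by exactly c.\<close>
    define s where "s = M / c + 1"
    have "s \<ge> 1" using \<open>0 \<le> M\<close> \<open>c > 0\<close> by (simp add: s_def)
    then have "s \<le> s\<^sup>2" by (simp add: power2_eq_square)
    then have "c * s \<le> M"
      using M[of s] \<open>s \<ge> 1\<close> \<open>c > 0\<close> by (smt (verit) mult_left_mono)
    moreover have "c * s = M + c" using \<open>c > 0\<close> by (simp add: s_def field_simps)
    ultimately show False using \<open>c > 0\<close> by simp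
  qed
  ultimately show ?thesis by (simp add: class_Kinf_def)
qed

text \<open>Only the quadratic transition zone needs an argument. With u = |s| - l in (0,
  \<epsilon>], the saturated value has modulus l + u - u^2/(2\<epsilon>), which falls short of the
  plateau l + \<epsilon>/2 by the nonnegative amount (u - \<epsilon>)^2/(2\<epsilon>).\<close>

lemma abs_sat_le:
  assumes "0 \<le> l" "0 < \<epsilon>"
  shows "\<bar>sat l \<epsilon> s\<bar> \<le> l + 0.5 * \<epsilon>"
proof (cases "l < \<bar>s\<bar> \<and> \<bar>s\<bar> \<le> l + \<epsilon>")
  case True
  define u where "u = \<bar>s\<bar> - l"
  have u: "0 < u" "u \<le> \<epsilon>" using True by (auto simp: u_def)
  have "s - sgn s * (u\<^sup>2 / (2 * \<epsilon>)) = sgn s * (l + u - u\<^sup>2 / (2 * \<epsilon>))"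
    using sgn_mult_abs[of s] by (simp add: u_def algebra_simps)
  then have "\<bar>sat l \<epsilon> s\<bar> = \<bar>l + u - u\<^sup>2 / (2 * \<epsilon>)\<bar>"
    using True assms by (auto simp: sat_def u_def abs_mult abs_sgn_eq)
  moreover have "u\<^sup>2 / (2 * \<epsilon>) \<le> u"
  proof -
    have "u * u \<le> u * (2 * \<epsilon>)"
      using u by (intro mult_left_mono) auto
    then show ?thesis using assms(2) by (simp add: divide_le_eq power2_eq_square)
  qed
  moreover have "u \<le> u\<^sup>2 / (2 * \<epsilon>) + 0.5 * \<epsilon>"
  proof -
    have "u\<^sup>2 / (2 * \<epsilon>) + 0.5 * \<epsilon> - u = (u - \<epsilon>)\<^sup>2 / (2 * \<epsilon>)"
      using assms(2) by (simp add: field_simps power2_eq_square)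
    moreover have "\<dots> \<ge> 0" using assms(2) by simp
    ultimately show ?thesis by linarith
  qed
  ultimately show ?thesis using assms(1) by linarith
next
  case False
  then show ?thesis using assms by (auto simp: sat_def abs_mult abs_sgn_eq)
qed

lemma satv_in_sat_cube:
  assumes "0 \<le> l" "0 < \<epsilon>"
  shows "satv l \<epsilon> v \<in> sat_cube l \<epsilon>"
  using abs_sat_le[OF assms] by (simp add: satv_def sat_cube_def)

lemma satv_eq_self:
  assumes "norm v \<le> l"
  shows "satv l \<epsilon> v = v"
proof -
  have "\<bar>v $ i\<bar> \<le> l" for i
    using component_le_norm_cart[of v i] assms by linarith
  then show ?thesis by (simp add: satv_def sat_def vec_eq_iff)
qed

text \<open>\<open>Delta_est\<close> is a difference of \<open>varphi\<close> at two saturated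
  points. Both lie in \<open>sat_cube\<close>, so the Lipschitz bound applies; saturation fixes
  \<theta>, so the distance between the points is the one controlled by
  \<open>\<gamma>\<^sub>s\<close>. Bounding that by its ceiling \<open>l\<^sub>\<gamma>\<close>
  removes the dependence on z.\<close>

lemma norm_Delta_est_le:
  assumes "0 \<le> l\<^sub>s" "0 < \<epsilon>\<^sub>s" "\<theta> \<in> \<Theta>" "norm \<theta> \<le> l\<^sub>s" "norm x \<le> r\<^sub>1"
    and gamma: "gamma_s_bound \<Theta> l\<^sub>s \<epsilon>\<^sub>s \<gamma>\<^sub>s l\<^sub>\<gamma>"
    and kappa: "kappa2_bound \<phi> S l\<^sub>s \<epsilon>\<^sub>s r\<^sub>1 \<kappa>\<^sub>2"
  shows "norm (Delta_est \<phi> S l\<^sub>s \<epsilon>\<^sub>s \<theta> z x e) \<le> \<kappa>\<^sub>2 (norm e) * l\<^sub>\<gamma>"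
proof -
  have "norm (Delta_est \<phi> S l\<^sub>s \<epsilon>\<^sub>s \<theta> z x e)
      \<le> \<kappa>\<^sub>2 (norm e) * norm (satv l\<^sub>s \<epsilon>\<^sub>s \<theta> - satv l\<^sub>s \<epsilon>\<^sub>s (\<theta> + z))"
    using kappa assms(5)
    by (simp add: kappa2_bound_def Delta_est_def satv_in_sat_cube[OF assms(1,2)])
  also have "norm (satv l\<^sub>s \<epsilon>\<^sub>s \<theta> - satv l\<^sub>s \<epsilon>\<^sub>s (\<theta> + z)) = norm (satv l\<^sub>s \<epsilon>\<^sub>s (\<theta> + z) - \<theta>)"
    using satv_eq_self[OF assms(4)] by (simp add: norm_minus_commute)
  also have "\<kappa>\<^sub>2 (norm e) * \<dots> \<le> \<kappa>\<^sub>2 (norm e) * l\<^sub>\<gamma>"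
  proof (rule mult_left_mono)
    have "norm (satv l\<^sub>s \<epsilon>\<^sub>s (\<theta> + z) - \<theta>) \<le> \<gamma>\<^sub>s (norm z)" "\<gamma>\<^sub>s (norm z) \<le> l\<^sub>\<gamma>"
      using gamma assms(3) by (auto simp: gamma_s_bound_def)
    then show "norm (satv l\<^sub>s \<epsilon>\<^sub>s (\<theta> + z) - \<theta>) \<le> l\<^sub>\<gamma>" by linarith
    show "0 \<le> \<kappa>\<^sub>2 (norm e)"
      using kappa class_K_nonneg[of \<kappa>\<^sub>2] by (simp add: kappa2_bound_def)
  qed
  finally show ?thesis .
qed

text \<open>\<open>frechet_derivative\<close> is defined by choice, so \<open>partial_z\<close> is
  known to be linear only once V t is shown differentiable. The slice at fixed t lies inside the
  half-space even for t = 0, so the joint derivative restricts to it and is two-sided in z.\<close>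

lemma C1_on_partial_z_bounded_linear:
  fixes V :: "real \<Rightarrow> 'z::real_normed_vector \<Rightarrow> real"
  assumes "C1_on ({0..} \<times> UNIV) (\<lambda>(t, z). V t z)" "0 \<le> t"
  shows "bounded_linear (partial_z V t z)"
proof -
  obtain f' :: "real \<times> 'z \<Rightarrow> (real \<times> 'z) \<Rightarrow>\<^sub>L real"
    where "\<And>p. p \<in> {0..} \<times> UNIV \<Longrightarrow>
      ((\<lambda>(t, z). V t z) has_derivative blinfun_apply (f' p)) (at p within {0..} \<times> UNIV)"
    using assms(1) unfolding C1_on_def by blast
  then have "((\<lambda>(t, z). V t z) has_derivative blinfun_apply (f' (t, z))) (at (t, z) within {0..} \<times> UNIV)"
    using assms(2) by simp
  moreover have "range (Pair t) \<subseteq> {0..} \<times> UNIV" using assms(2) by auto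
  ultimately have "((\<lambda>(t, z). V t z) has_derivative blinfun_apply (f' (t, z)))
      (at (t, z) within range (Pair t))"
    by (rule has_derivative_subset)
  moreover have "(Pair t has_derivative (\<lambda>h. (0, h))) (at z)"
    by (auto intro!: derivative_eq_intros)
  ultimately have "((\<lambda>z. V t z) has_derivative (\<lambda>h. blinfun_apply (f' (t, z)) (0, h))) (at z)"
    using has_derivative_in_compose[of "Pair t" _ z UNIV "\<lambda>(t, z). V t z"] by simp
  then have "V t differentiable at z"
    by (auto simp: differentiable_def)
  then show ?thesis
    unfolding partial_z_def by (simp add: frechet_derivative_works has_derivative_bounded_linear)
qed

text \<open>The linear growth of the gradient absorbs a perturbation that is small relative to the
  state; \<open>a\<^sub>2 |z|\<^sup>2\<close> dominates \<open>V\<close>, so that a lower bound on \<open>V\<close> bounds \<open>|z|\<close> from below.\<close>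

lemma perturbed_decay:
  fixes V :: "real \<Rightarrow> real^'q \<Rightarrow> real"
  assumes V: "est_Lyapunov F V a\<^sub>1 a\<^sub>2 a\<^sub>3 a\<^sub>4"
    and "0 \<le> t" "1 < \<tau>" "0 \<le> d" and pert: "norm v \<le> d"
    and large: "a\<^sub>1 * (\<tau> * a_star a\<^sub>1 a\<^sub>2 a\<^sub>3 a\<^sub>4)\<^sup>2 * d\<^sup>2 \<le> V t z"
  shows "deriv_along V t z (F t z + v) \<le> - (a\<^sub>3 * (\<tau> - 1) / \<tau>) * (norm z)\<^sup>2"
proof -
  have a: "a\<^sub>1 > 0" "a\<^sub>2 > 0" "a\<^sub>3 > 0" "a\<^sub>4 > 0"
    and upper: "V t z \<le> a\<^sub>2 * (norm z)\<^sup>2"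
    and decay: "deriv_along V t z (F t z) \<le> - a\<^sub>3 * (norm z)\<^sup>2"
    and grad: "onorm (partial_z V t z) \<le> a\<^sub>4 * norm z"
    using V \<open>0 \<le> t\<close> by (auto simp: est_Lyapunov_def)
  have bl: "bounded_linear (partial_z V t z)"
    using V \<open>0 \<le> t\<close> by (auto simp: est_Lyapunov_def intro: C1_on_partial_z_bounded_linear)
  \<comment> \<open>The ratio \<open>sqrt a\<^sub>2 / sqrt a\<^sub>1\<close> in
    \<open>a_star\<close> exchanges the factor \<open>a\<^sub>1\<close> for
    \<open>a\<^sub>2\<close>, which then cancels against the upper bound on V.\<close>
  have "a\<^sub>1 * (\<tau> * a_star a\<^sub>1 a\<^sub>2 a\<^sub>3 a\<^sub>4)\<^sup>2 * d\<^sup>2 = a\<^sub>2 * (\<tau> * a\<^sub>4 * d / a\<^sub>3)\<^sup>2"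
    using a by (simp add: a_star_def power_divide power_mult_distrib)
  then have "a\<^sub>2 * (\<tau> * a\<^sub>4 * d / a\<^sub>3)\<^sup>2 \<le> a\<^sub>2 * (norm z)\<^sup>2"
    using large upper by linarith
  then have "(\<tau> * a\<^sub>4 * d / a\<^sub>3)\<^sup>2 \<le> (norm z)\<^sup>2"
    using a(2) by simp
  then have "\<tau> * a\<^sub>4 * d / a\<^sub>3 \<le> norm z"
    by (rule power2_le_imp_le) simp
  then have small: "a\<^sub>4 * d \<le> a\<^sub>3 / \<tau> * norm z"
    using a \<open>1 < \<tau>\<close> by (simp add: field_simps)
  have "partial_z V t z v \<le> norm (partial_z V t z v)" by simp
  also have "\<dots> \<le> onorm (partial_z V t z) * norm v"
    by (rule onorm[OF bl])
  also have "\<dots> \<le> (a\<^sub>4 * norm z) * d"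
    using grad pert a by (intro mult_mono) auto
  also have "\<dots> = a\<^sub>4 * d * norm z" by simp
  also have "\<dots> \<le> a\<^sub>3 / \<tau> * norm z * norm z"
    using small by (rule mult_right_mono) simp
  finally have "partial_z V t z v \<le> a\<^sub>3 / \<tau> * (norm z)\<^sup>2"
    by (simp add: power2_eq_square mult.assoc)
  moreover have "deriv_along V t z (F t z + v) = deriv_along V t z (F t z) + partial_z V t z v"
    by (simp add: deriv_along_def linear_add[OF bounded_linear.linear[OF bl]])
  \<comment> \<open>The share 1/\<tau> of the nominal decay pays for the perturbation; the share 1 -
    1/\<tau> remains.\<close>
  moreover have "- (a\<^sub>3 * (\<tau> - 1) / \<tau>) * (norm z)\<^sup>2 = - a\<^sub>3 * (norm z)\<^sup>2 + a\<^sub>3 / \<tau> * (norm z)\<^sup>2"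
    using \<open>1 < \<tau>\<close> by (simp add: field_simps)
  ultimately show ?thesis using decay by linarith
qed

theorem lemma3:
  fixes \<Theta> :: "(real^'q) set" and \<theta> :: "real^'q"
    and \<phi> :: "real^'q \<Rightarrow> real^'n \<Rightarrow> real^'n"
    and x\<^sub>r :: "real \<Rightarrow> real^'n"
    and S :: "real^'n \<Rightarrow> real^'n^'q"
    and \<gamma>\<^sub>s \<kappa>\<^sub>2 :: "real \<Rightarrow> real"
    and V_est :: "real \<Rightarrow> real^'q \<Rightarrow> real"
    and r\<^sub>1 l\<^sub>\<theta> l\<^sub>s \<epsilon>\<^sub>s l\<^sub>\<gamma> kdz kdz_star a\<^sub>1 a\<^sub>2 a\<^sub>3 a\<^sub>4 :: real
  assumes "compact \<Theta>" and "\<theta> \<in> \<Theta>"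
    and "\<forall>\<theta>'\<in>\<Theta>. norm \<theta>' \<le> l\<^sub>\<theta>"
    and "l\<^sub>\<theta> < l\<^sub>s" and "0 < \<epsilon>\<^sub>s" and "\<epsilon>\<^sub>s \<le> 1"
    and "smooth_regressor \<phi>"
    and "C1_bounded_reference x\<^sub>r r\<^sub>1"
    and "persistent_excitation \<Theta> \<phi> x\<^sub>r l\<^sub>\<theta> l\<^sub>s S"
    and "gamma_s_bound \<Theta> l\<^sub>s \<epsilon>\<^sub>s \<gamma>\<^sub>s l\<^sub>\<gamma>"
    and "kappa2_bound \<phi> S l\<^sub>s \<epsilon>\<^sub>s r\<^sub>1 \<kappa>\<^sub>2"
    and "0 < kdz_star"
    and "\<forall>k\<ge>kdz_star. \<exists>V b\<^sub>1 b\<^sub>2 b\<^sub>3 b\<^sub>4.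
      est_Lyapunov (\<lambda>t z. H_est \<phi> S l\<^sub>\<theta> l\<^sub>s \<epsilon>\<^sub>s k \<theta> z (x\<^sub>r t)) V b\<^sub>1 b\<^sub>2 b\<^sub>3 b\<^sub>4"
    and "kdz_star \<le> kdz"
    and "est_Lyapunov (\<lambda>t z. H_est \<phi> S l\<^sub>\<theta> l\<^sub>s \<epsilon>\<^sub>s kdz \<theta> z (x\<^sub>r t)) V_est a\<^sub>1 a\<^sub>2 a\<^sub>3 a\<^sub>4"
  shows "uniformly_ISS (est_error_system \<phi> S l\<^sub>\<theta> l\<^sub>s \<epsilon>\<^sub>s kdz x\<^sub>r \<theta>) \<and>
    uniform_ISS_Lyapunov (est_error_system \<phi> S l\<^sub>\<theta> l\<^sub>s \<epsilon>\<^sub>s kdz x\<^sub>r \<theta>) V_est \<and>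
    (\<forall>t\<ge>0. \<forall>z. a\<^sub>1 * (norm z)\<^sup>2 \<le> V_est t z \<and> V_est t z \<le> a\<^sub>2 * (norm z)\<^sup>2 \<and>
      onorm (partial_z V_est t z) \<le> a\<^sub>4 * norm z) \<and>
    (\<forall>\<tau>>1. \<forall>t\<ge>0. \<forall>z e.
      sigma_est a\<^sub>1 a\<^sub>2 a\<^sub>3 a\<^sub>4 l\<^sub>\<gamma> \<kappa>\<^sub>2 \<tau> (norm e) \<le> V_est t z \<longrightarrow>
      deriv_along V_est t z (est_error_system \<phi> S l\<^sub>\<theta> l\<^sub>s \<epsilon>\<^sub>s kdz x\<^sub>r \<theta> t z e)
        \<le> - (a\<^sub>3 * (\<tau> - 1) / \<tau>) * (norm z)\<^sup>2)"
proof -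
  let ?f = "est_error_system \<phi> S l\<^sub>\<theta> l\<^sub>s \<epsilon>\<^sub>s kdz x\<^sub>r \<theta>"
  note gamma = \<open>gamma_s_bound \<Theta> l\<^sub>s \<epsilon>\<^sub>s \<gamma>\<^sub>s l\<^sub>\<gamma>\<close>
  note kappa = \<open>kappa2_bound \<phi> S l\<^sub>s \<epsilon>\<^sub>s r\<^sub>1 \<kappa>\<^sub>2\<close>
  note V = \<open>est_Lyapunov (\<lambda>t z. H_est \<phi> S l\<^sub>\<theta> l\<^sub>s \<epsilon>\<^sub>s kdz \<theta> z (x\<^sub>r t)) V_est a\<^sub>1 a\<^sub>2 a\<^sub>3 a\<^sub>4\<close>
  have a: "a\<^sub>1 > 0" "a\<^sub>2 > 0" "a\<^sub>3 > 0" "a\<^sub>4 > 0"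
    and C1: "C1_on ({0..} \<times> UNIV) (\<lambda>(t, z). V_est t z)"
    and bounds: "\<forall>t\<ge>0. \<forall>z. 0 \<le> V_est t z \<and> a\<^sub>1 * (norm z)\<^sup>2 \<le> V_est t z \<and>
      V_est t z \<le> a\<^sub>2 * (norm z)\<^sup>2 \<and> onorm (partial_z V_est t z) \<le> a\<^sub>4 * norm z"
    using V by (auto simp: est_Lyapunov_def)
  have "norm \<theta> \<le> l\<^sub>s"
    using \<open>\<theta> \<in> \<Theta>\<close> \<open>\<forall>\<theta>'\<in>\<Theta>. norm \<theta>' \<le> l\<^sub>\<theta>\<close> \<open>l\<^sub>\<theta> < l\<^sub>s\<close> by fastforce
  then have "0 \<le> l\<^sub>s" using norm_ge_zero order_trans by blast
  have "l\<^sub>\<gamma> > 0" using gamma by (simp add: gamma_s_bound_def)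
  have "\<kappa>\<^sub>2 \<in> class_K" using kappa by (simp add: kappa2_bound_def)
  have dissipation: "deriv_along V_est t z (?f t z e) \<le> - (a\<^sub>3 * (\<tau> - 1) / \<tau>) * (norm z)\<^sup>2"
    if "\<tau> > 1" "t \<ge> 0" and large: "sigma_est a\<^sub>1 a\<^sub>2 a\<^sub>3 a\<^sub>4 l\<^sub>\<gamma> \<kappa>\<^sub>2 \<tau> (norm e) \<le> V_est t z"
    for \<tau> t z e
  proof -
    have "norm (x\<^sub>r t) \<le> r\<^sub>1"
      using \<open>C1_bounded_reference x\<^sub>r r\<^sub>1\<close> \<open>t \<ge> 0\<close> by (simp add: C1_bounded_reference_def)
    then have "norm (Delta_est \<phi> S l\<^sub>s \<epsilon>\<^sub>s \<theta> z (x\<^sub>r t) e) \<le> \<kappa>\<^sub>2 (norm e) * l\<^sub>\<gamma>"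
      using norm_Delta_est_le \<open>0 \<le> l\<^sub>s\<close> \<open>0 < \<epsilon>\<^sub>s\<close> \<open>\<theta> \<in> \<Theta>\<close> \<open>norm \<theta> \<le> l\<^sub>s\<close> gamma kappa by blast
    moreover have "0 \<le> \<kappa>\<^sub>2 (norm e) * l\<^sub>\<gamma>"
      using class_K_nonneg[OF \<open>\<kappa>\<^sub>2 \<in> class_K\<close>] \<open>l\<^sub>\<gamma> > 0\<close> by simp
    \<comment> \<open>Regrouping \<open>sigma_est\<close> exposes the threshold of
      \<open>perturbed_decay\<close> with d =
      \<open>\<kappa>\<^sub>2 (norm e) * l\<^sub>\<gamma>\<close>.\<close>
    moreover have "a\<^sub>1 * (\<tau> * a_star a\<^sub>1 a\<^sub>2 a\<^sub>3 a\<^sub>4)\<^sup>2 * (\<kappa>\<^sub>2 (norm e) * l\<^sub>\<gamma>)\<^sup>2 \<le> V_est t z"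
      using large by (simp add: sigma_est_def power_mult_distrib mult_ac)
    ultimately show ?thesis
      unfolding est_error_system_def by (intro perturbed_decay[OF V] that)
  qed
  have lyapunov: "uniform_ISS_Lyapunov ?f V_est"
    unfolding uniform_ISS_Lyapunov_def
  proof (intro conjI bexI)
    show "\<forall>t\<ge>0. \<forall>z. a\<^sub>1 * (norm z)\<^sup>2 \<le> V_est t z \<and> V_est t z \<le> a\<^sub>2 * (norm z)\<^sup>2"
      using bounds by blast
    \<comment> \<open>The ISS definition asks for a single gain and decay rate; any \<tau> > 1 would
      do, and \<tau> = 2 leaves half of the nominal decay.\<close>
    show "\<forall>t\<ge>0. \<forall>z e. sigma_est a\<^sub>1 a\<^sub>2 a\<^sub>3 a\<^sub>4 l\<^sub>\<gamma> \<kappa>\<^sub>2 2 (norm e) \<le> V_est t z \<longrightarrow>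
        deriv_along V_est t z (?f t z e) \<le> - (a\<^sub>3 / 2 * (norm z)\<^sup>2)"
      using dissipation[of 2] by simp
    have "a_star a\<^sub>1 a\<^sub>2 a\<^sub>3 a\<^sub>4 > 0" using a by (simp add: a_star_def)
    then show "sigma_est a\<^sub>1 a\<^sub>2 a\<^sub>3 a\<^sub>4 l\<^sub>\<gamma> \<kappa>\<^sub>2 2 \<in> class_K"
      unfolding sigma_est_def [abs_def]
      using a \<open>l\<^sub>\<gamma> > 0\<close> \<open>\<kappa>\<^sub>2 \<in> class_K\<close> by (intro class_K_scaled_square) auto
    show "(\<lambda>s. a\<^sub>3 / 2 * s\<^sup>2) \<in> class_Kinf"
      using a by (intro class_Kinf_scaled_square) simp
  qed (use C1 bounds a in \<open>auto intro: class_Kinf_scaled_square\<close>)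
  then show ?thesis
    using bounds dissipation by (auto simp: uniformly_ISS_def)
qed

end
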